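(* Let $n\ge 1$ and let $A$ be an $n\times n$ complex matrix. Then, as linear maps $V\to V$, $$S_{n-1}\circ (R_A)^{\otimes (n-1)}\circ T_1\circ A \;=\; (-1)^{\lfloor n/2\rfloor}\,(n-1)!\,\det(A)\,\mathrm{id}_V .$$
   Context: $V=\mathbb{C}^n$ is the space of column vectors with standard basis $\hat e_1,\dots,\hat e_n$, and $V^*$ is the space of row vectors of length $n$ with dual basis $\hat e^1,\dots,\hat e^n$. An $n\times n$ matrix $A$ acts on $V$ by $v\mapsto Av$, and $R_A:V^*\to V^*$ denotes $w\mapsto wA$ (a matrix on a strand directed from top to bottom in a diagram). For $0\le k\le n$, $T_k:V^{\otimes k}\to (V^* )^{\otimes (n-k)}$ is the function of the trace diagram with a single sink vertex of degree $n$ with $k$ input strands below and $n-k$ output strands above (edges ordered counterclockwise starting from the left), i.e. the linear map $$T_k(v_1\otimes\cdots\otimes v_k)=\sum_{i_1,\dots,i_{n-k}=1}^n \det[v_1\ \cdots\ v_k\ \hat e_{i_{n-k}}\ \cdots\ \hat e_{i_1}]\ \hat e^{i_1}\otimes\cdots\otimes \hat e^{i_{n-k}}.$$ Likewise $S_k:(V^* )^{\otimes k}\to V^{\otimes (n-k)}$ is the function of the corresponding diagram with a source vertex: $$S_k(w_1\otimes\cdots\otimes w_k)=\sum_{i_1,\dots,i_{n-k}=1}^n \det\big(\text{matrix with rows } w_1,\dots,w_k,\hat e^{i_{n-k}},\dots,\hat e^{i_1}\big)\ \hat e_{i_1}\otimes\cdots\otimes \hat e_{i_{n-k}}.$$ Vertical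 stacking of diagrams is composition of functions. The left side of the identity is the function of the diagram in which one strand labelled $A$ enters a sink vertex from below, $n-1$ strands, each labelled $A$, run from a source vertex above down to the sink vertex, and one unlabelled strand leaves the source vertex at the top. *)

theory Defs
  imports "Jordan_Normal_Form.Determinant"
begin

text \<open>
  \<open>V\<close> and \<open>V\<^sup>*\<close> are both modelled by \<open>carrier_vec n\<close> over the complex numbers, with
  \<open>unit_vec n i\<close> serving as the standard basis vector of \<open>V\<close> (a column) and as the dual basis
  vector of \<open>V\<^sup>*\<close> (a row); which one is meant is determined by the position of the vector in a
  determinant and by the side on which matrices act. Indices run through \<open>{..<n}\<close> instead of
  \<open>{1..n}\<close>.

  An element of the \<open>k\<close>-th tensor power of either space is represented by its coordinate array with
  respect to the basis \<open>e i\<^sub>1 \<otimes> \<dots> \<otimes> e i\<^sub>k\<close>, indexed by the lists \<open>[i\<^sub>1, \<dots>, i\<^sub>k]\<close>, and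
  extended by \<open>0\<close> to all other lists.
\<close>

type_synonym tensor = "nat list \<Rightarrow> complex"

definition tensor_idx :: "nat \<Rightarrow> nat \<Rightarrow> nat list set" where
  "tensor_idx n k = {is. length is = k \<and> set is \<subseteq> {..<n}}"

definition tensors :: "nat \<Rightarrow> nat \<Rightarrow> tensor set" where
  "tensors n k = {x. \<forall>is. is \<notin> tensor_idx n k \<longrightarrow> x is = 0}"

text \<open>The list \<open>[v\<^sub>1, \<dots>, v\<^sub>k]\<close> is sent to \<open>v\<^sub>1 \<otimes> \<dots> \<otimes> v\<^sub>k\<close>.\<close>

definition pure_tensor :: "nat \<Rightarrow> complex vec list \<Rightarrow> tensor" where
  "pure_tensor n vs =
     (\<lambda>is. if is \<in> tensor_idx n (length vs) then (\<Prod>l<length vs. (vs ! l) $ (is ! l)) else 0)"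

definition multilinear :: "nat \<Rightarrow> nat \<Rightarrow> (complex vec list \<Rightarrow> tensor) \<Rightarrow> bool" where
  "multilinear n k F \<longleftrightarrow>
     (\<forall>us ws v w a b js. length us + 1 + length ws = k \<longrightarrow>
        set us \<subseteq> carrier_vec n \<longrightarrow> set ws \<subseteq> carrier_vec n \<longrightarrow>
        v \<in> carrier_vec n \<longrightarrow> w \<in> carrier_vec n \<longrightarrow>
        F (us @ (a \<cdot>\<^sub>v v + b \<cdot>\<^sub>v w) # ws) js = a * F (us @ v # ws) js + b * F (us @ w # ws) js)"

text \<open>
  The linear map on the \<open>k\<close>-th tensor power that sends \<open>v\<^sub>1 \<otimes> \<dots> \<otimes> v\<^sub>k\<close> to
  \<open>F [v\<^sub>1, \<dots>, v\<^sub>k]\<close>, for multilinear \<open>F\<close>. It is defined through the values of \<open>F\<close> on basis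
  vectors; the lemmas \<open>tensor_lift_pure\<close> and \<open>tensor_lift_unique\<close> below give its universal property.
\<close>

definition tensor_lift :: "nat \<Rightarrow> nat \<Rightarrow> (complex vec list \<Rightarrow> tensor) \<Rightarrow> tensor \<Rightarrow> tensor" where
  "tensor_lift n k F x = (\<lambda>js. \<Sum>is\<in>tensor_idx n k. x is * F (map (unit_vec n) is) js)"

text \<open>
  The values of the sink and source vertex functions on \<open>v\<^sub>1 \<otimes> \<dots> \<otimes> v\<^sub>k\<close>. The summation
  variable is the list \<open>[i\<^sub>1, \<dots>, i\<^bsub>n-k\<^esub>]\<close>, which enters the determinant in reversed order.
\<close>

definition sink_values :: "nat \<Rightarrow> nat \<Rightarrow> complex vec list \<Rightarrow> tensor" where
  "sink_values n k vs = (\<lambda>js. \<Sum>is\<in>tensor_idx n (n - k).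
     det (mat_of_cols n (vs @ map (unit_vec n) (rev is))) * pure_tensor n (map (unit_vec n) is) js)"

definition source_values :: "nat \<Rightarrow> nat \<Rightarrow> complex vec list \<Rightarrow> tensor" where
  "source_values n k ws = (\<lambda>js. \<Sum>is\<in>tensor_idx n (n - k).
     det (mat_of_rows n (ws @ map (unit_vec n) (rev is))) * pure_tensor n (map (unit_vec n) is) js)"

text \<open>\<open>sink_map n k\<close> is \<open>T\<^sub>k\<close> and \<open>source_map n k\<close> is \<open>S\<^sub>k\<close>.\<close>

definition sink_map :: "nat \<Rightarrow> nat \<Rightarrow> tensor \<Rightarrow> tensor" where
  "sink_map n k = tensor_lift n k (sink_values n k)"

definition source_map :: "nat \<Rightarrow> nat \<Rightarrow> tensor \<Rightarrow> tensor" where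
  "source_map n k = tensor_lift n k (source_values n k)"

text \<open>\<open>row_action A\<close> is \<open>R\<^sub>A\<close>, sending the row vector \<open>w\<close> to \<open>w A\<close>.\<close>

definition row_action :: "complex mat \<Rightarrow> complex vec \<Rightarrow> complex vec" where
  "row_action A w = vec (dim_col A) (\<lambda>j. w \<bullet> col A j)"

definition tensor_power_map ::
  "nat \<Rightarrow> nat \<Rightarrow> (complex vec \<Rightarrow> complex vec) \<Rightarrow> tensor \<Rightarrow> tensor" where
  "tensor_power_map n k f = tensor_lift n k (\<lambda>ws. pure_tensor n (map f ws))"

text \<open>The canonical identification of \<open>V\<close> with its first tensor power, in both directions.\<close>

definition to_tensor1 :: "nat \<Rightarrow> complex vec \<Rightarrow> tensor" where
  "to_tensor1 n v = pure_tensor n [v]"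

definition of_tensor1 :: "nat \<Rightarrow> tensor \<Rightarrow> complex vec" where
  "of_tensor1 n x = vec n (\<lambda>i. x [i])"


subsection \<open>Justification of the coordinate definitions\<close>

lemma finite_tensor_idx [simp]: "finite (tensor_idx n k)"
  using finite_lists_length_eq[of "{..<n}" k] by (simp add: tensor_idx_def conj_commute)

lemma tensor_idx_0 [simp]: "tensor_idx n 0 = {[]}"
  by (auto simp: tensor_idx_def)

lemma sum_tensor_idx_Suc:
  fixes g :: "nat list \<Rightarrow> complex"
  shows "(\<Sum>is\<in>tensor_idx n (Suc k). g is) = (\<Sum>i<n. \<Sum>is\<in>tensor_idx n k. g (i # is))"
proof -
  have eq: "tensor_idx n (Suc k) = (\<lambda>(i, is). i # is) ` ({..<n} \<times> tensor_idx n k)"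
    by (force simp: tensor_idx_def length_Suc_conv)
  have "inj_on (\<lambda>(i, is). i # is) ({..<n} \<times> tensor_idx n k)"
    by (auto simp: inj_on_def)
  then show ?thesis
    by (simp add: eq sum.reindex sum.cartesian_product case_prod_unfold)
qed

lemma multilinear_expand:
  assumes F: "multilinear n k F" and len: "length us + 1 + length ws = k"
    and us: "set us \<subseteq> carrier_vec n" and ws: "set ws \<subseteq> carrier_vec n" and v: "v \<in> carrier_vec n"
  shows "F (us @ v # ws) js = (\<Sum>i<n. v $ i * F (us @ unit_vec n i # ws) js)"
proof -
  have lin: "F (us @ (a \<cdot>\<^sub>v x + b \<cdot>\<^sub>v y) # ws) js = a * F (us @ x # ws) js + b * F (us @ y # ws) js"
    if "x \<in> carrier_vec n" "y \<in> carrier_vec n" for a b x y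
    using F len us ws that unfolding multilinear_def by blast
  let ?v = "\<lambda>m. vec n (\<lambda>i. if i < m then v $ i else 0)"
  have "m \<le> n \<Longrightarrow> F (us @ ?v m # ws) js = (\<Sum>i<m. v $ i * F (us @ unit_vec n i # ws) js)" for m
  proof (induction m)
    case 0
    have "?v 0 = 0 \<cdot>\<^sub>v 0\<^sub>v n + 0 \<cdot>\<^sub>v 0\<^sub>v n" by auto
    then show ?case using lin[of "0\<^sub>v n" "0\<^sub>v n" 0 0] by simp
  next
    case (Suc m)
    have "?v (Suc m) = 1 \<cdot>\<^sub>v ?v m + (v $ m) \<cdot>\<^sub>v unit_vec n m"
      by (rule eq_vecI) (use Suc.prems in \<open>auto simp: unit_vec_def less_Suc_eq\<close>)
    then show ?case using lin[of "?v m" "unit_vec n m" 1 "v $ m"] Suc by simp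
  qed
  note step = this[OF order_refl]
  have "?v n = v" using v by auto
  then show ?thesis using step by (simp only:)
qed

lemma multilinear_expand_all:
  assumes F: "multilinear n k F"
  shows "length us + length vs = k \<Longrightarrow> set us \<subseteq> carrier_vec n \<Longrightarrow> set vs \<subseteq> carrier_vec n \<Longrightarrow>
    F (us @ vs) js = (\<Sum>is\<in>tensor_idx n (length vs).
      (\<Prod>l<length vs. (vs ! l) $ (is ! l)) * F (us @ map (unit_vec n) is) js)"
proof (induction vs arbitrary: us)
  case Nil
  then show ?case by simp
next
  case (Cons v vs)
  have IH: "F (us @ unit_vec n i # vs) js = (\<Sum>is\<in>tensor_idx n (length vs).
      (\<Prod>l<length vs. (vs ! l) $ (is ! l)) * F (us @ unit_vec n i # map (unit_vec n) is) js)" for i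
    using Cons.IH[of "us @ [unit_vec n i]"] Cons.prems by simp
  have "F (us @ v # vs) js = (\<Sum>i<n. v $ i * F (us @ unit_vec n i # vs) js)"
    using Cons.prems by (intro multilinear_expand[OF F]) auto
  also have "\<dots> = (\<Sum>is\<in>tensor_idx n (Suc (length vs)).
      (\<Prod>l<Suc (length vs). ((v # vs) ! l) $ (is ! l)) * F (us @ map (unit_vec n) is) js)"
    unfolding sum_tensor_idx_Suc IH
    by (simp add: sum_distrib_left prod.lessThan_Suc_shift mult.assoc del: prod.lessThan_Suc)
  finally show ?case by simp
qed

theorem tensor_lift_pure:
  assumes "multilinear n k F" "length vs = k" "set vs \<subseteq> carrier_vec n"
  shows "tensor_lift n k F (pure_tensor n vs) = F vs"
  using multilinear_expand_all[OF assms(1), of "[]" vs] assms(2,3)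
  by (auto simp: tensor_lift_def pure_tensor_def intro!: ext sum.cong)

lemma pure_tensor_unit_vec:
  assumes "is \<in> tensor_idx n k"
  shows "pure_tensor n (map (unit_vec n) is) js = (if js = is then 1 else 0)"
proof (cases "js \<in> tensor_idx n k")
  case True
  have *: "is ! l < n" "js ! l < n" if "l < k" for l
    using assms True that by (auto simp: tensor_idx_def subset_iff)
  have "pure_tensor n (map (unit_vec n) is) js = (\<Prod>l<k. if js ! l = is ! l then 1 else 0)"
    using assms True * by (auto simp: pure_tensor_def tensor_idx_def unit_vec_def intro!: prod.cong)
  also have "\<dots> = (if js = is then 1 else 0)"
    using assms True by (auto simp: tensor_idx_def list_eq_iff_nth_eq)
  finally show ?thesis .
next
  case False
  then show ?thesis using assms by (auto simp: pure_tensor_def tensor_idx_def)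
qed

theorem tensor_lift_unique:
  assumes add: "\<And>x y. x \<in> tensors n k \<Longrightarrow> y \<in> tensors n k \<Longrightarrow> G (\<lambda>js. x js + y js) = (\<lambda>js. G x js + G y js)"
    and scale: "\<And>c x. x \<in> tensors n k \<Longrightarrow> G (\<lambda>js. c * x js) = (\<lambda>js. c * G x js)"
    and pure: "\<And>vs. length vs = k \<Longrightarrow> set vs \<subseteq> carrier_vec n \<Longrightarrow> G (pure_tensor n vs) = F vs"
    and x: "x \<in> tensors n k"
  shows "G x = tensor_lift n k F x"
proof -
  let ?e = "\<lambda>is. pure_tensor n (map (unit_vec n) is)"
  have e: "?e is \<in> tensors n k" if "is \<in> tensor_idx n k" for "is"
    using that by (auto simp: tensors_def pure_tensor_unit_vec)
  have Ge: "G (?e is) = F (map (unit_vec n) is)" if "is \<in> tensor_idx n k" for "is"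
    using that by (intro pure) (auto simp: tensor_idx_def)
  have "A \<subseteq> tensor_idx n k \<Longrightarrow> G (\<lambda>js. \<Sum>is\<in>A. x is * ?e is js) =
      (\<lambda>js. \<Sum>is\<in>A. x is * F (map (unit_vec n) is) js)" if "finite A" for A
    using that
  proof (induction A rule: finite_induct)
    case empty
    have "(\<lambda>_. 0) \<in> tensors n k" by (simp add: tensors_def)
    from scale[OF this, of 0] show ?case by simp
  next
    case (insert i A)
    have i: "i \<in> tensor_idx n k" using insert by auto
    have "(\<lambda>js. \<Sum>is\<in>A. x is * ?e is js) \<in> tensors n k"
      using insert.prems e by (auto simp: tensors_def subset_iff intro!: sum.neutral)
    moreover have "(\<lambda>js. x i * ?e i js) \<in> tensors n k" using e[OF i] by (auto simp: tensors_def)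
    ultimately show ?case
      using insert add scale[OF e[OF i], of "x i"] Ge[OF i] by simp
  qed
  from this[OF finite_tensor_idx order_refl]
  have "G (\<lambda>js. \<Sum>is\<in>tensor_idx n k. x is * ?e is js) = tensor_lift n k F x"
    by (simp add: tensor_lift_def)
  moreover have "(\<lambda>js. \<Sum>is\<in>tensor_idx n k. x is * ?e is js) = x"
  proof
    fix js
    have "(\<Sum>is\<in>tensor_idx n k. x is * ?e is js) = (\<Sum>is\<in>tensor_idx n k. if js = is then x is else 0)"
      by (intro sum.cong) (auto simp: pure_tensor_unit_vec)
    also have "\<dots> = x js" using x by (auto simp: tensors_def)
    finally show "(\<Sum>is\<in>tensor_idx n k. x is * ?e is js) = x js" .
  qed
  ultimately show ?thesis by simp
qed

lemma prod_slot:
  fixes h :: "nat \<Rightarrow> complex vec \<Rightarrow> complex"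
  assumes m: "length us < m"
    and lin: "h (length us) u = a * h (length us) v + b * h (length us) w"
  shows "(\<Prod>l<m. h l ((us @ u # ws) ! l)) =
    a * (\<Prod>l<m. h l ((us @ v # ws) ! l)) + b * (\<Prod>l<m. h l ((us @ w # ws) ! l))"
proof -
  have split: "(\<Prod>l<m. h l ((us @ x # ws) ! l)) =
      h (length us) x * (\<Prod>l\<in>{..<m} - {length us}. h l ((us @ u # ws) ! l))" for x
  proof -
    have "(\<Prod>l\<in>{..<m} - {length us}. h l ((us @ x # ws) ! l)) =
        (\<Prod>l\<in>{..<m} - {length us}. h l ((us @ u # ws) ! l))"
      by (rule prod.cong) (simp_all add: nth_append nth_Cons')
    then show ?thesis
      using m prod.remove[of "{..<m}" "length us" "\<lambda>l. h l ((us @ x # ws) ! l)"] by simp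
  qed
  show ?thesis
    unfolding split[of u] split[of v] split[of w] lin by (simp add: algebra_simps)
qed

lemma det_rows_slot:
  fixes v w :: "complex vec"
  assumes len: "length us + 1 + length ws = n" and vw: "v \<in> carrier_vec n" "w \<in> carrier_vec n"
  shows "det (mat_of_rows n (us @ (a \<cdot>\<^sub>v v + b \<cdot>\<^sub>v w) # ws)) =
    a * det (mat_of_rows n (us @ v # ws)) + b * det (mat_of_rows n (us @ w # ws))"
proof -
  have det: "det (mat_of_rows n (us @ x # ws)) = (\<Sum>p\<in>{p. p permutes {0..<n}}.
      signof p * (\<Prod>i<n. ((us @ x # ws) ! i) $ p i))" for x
    using len by (subst det_def'[of _ n])
      (auto simp: mat_of_rows_index atLeast0LessThan mat_of_rows_def permutes_in_image
        intro!: sum.cong prod.cong)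
  have slot: "(\<Prod>i<n. ((us @ (a \<cdot>\<^sub>v v + b \<cdot>\<^sub>v w) # ws) ! i) $ p i) =
      a * (\<Prod>i<n. ((us @ v # ws) ! i) $ p i) + b * (\<Prod>i<n. ((us @ w # ws) ! i) $ p i)"
    if "p permutes {0..<n}" for p
    using len vw permutes_in_image[OF that, of "length us"]
    by (intro prod_slot[where h = "\<lambda>i x. x $ p i"]) auto
  show ?thesis unfolding det
    by (simp add: slot sum_distrib_left flip: sum.distrib) (simp add: algebra_simps)
qed

lemma det_cols_eq_det_rows:
  assumes "length vs = n"
  shows "det (mat_of_cols n vs :: complex mat) = det (mat_of_rows n vs)"
proof -
  have "mat_of_rows n vs \<in> carrier_mat n n" using assms by (simp add: mat_of_rows_def)
  from det_transpose[OF this] show ?thesis by (simp add: transpose_mat_of_rows)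
qed

lemma multilinear_source_values:
  assumes "k \<le> n" shows "multilinear n k (source_values n k)"
  unfolding multilinear_def
proof (intro allI impI)
  fix us ws :: "complex vec list" and v w :: "complex vec" and a b :: complex and js
  assume len: "length us + 1 + length ws = k" and "v \<in> carrier_vec n" "w \<in> carrier_vec n"
  then have *: "det (mat_of_rows n (us @ (a \<cdot>\<^sub>v v + b \<cdot>\<^sub>v w) # ws @ map (unit_vec n) (rev is))) =
      a * det (mat_of_rows n (us @ v # ws @ map (unit_vec n) (rev is))) +
      b * det (mat_of_rows n (us @ w # ws @ map (unit_vec n) (rev is)))"
    if "is \<in> tensor_idx n (n - k)" for "is"
    using that assms by (intro det_rows_slot) (auto simp: tensor_idx_def)
  show "source_values n k (us @ (a \<cdot>\<^sub>v v + b \<cdot>\<^sub>v w) # ws) js =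
      a * source_values n k (us @ v # ws) js + b * source_values n k (us @ w # ws) js"
    by (simp add: source_values_def * sum_distrib_left algebra_simps flip: sum.distrib)
qed

lemma sink_values_eq_source_values:
  assumes "k \<le> n" "length vs = k" shows "sink_values n k vs = source_values n k vs"
  unfolding sink_values_def source_values_def using assms
  by (intro ext sum.cong) (auto simp: tensor_idx_def det_cols_eq_det_rows)

lemma multilinear_sink_values:
  assumes "k \<le> n" shows "multilinear n k (sink_values n k)"
  using multilinear_source_values[OF assms] assms
  by (simp add: multilinear_def sink_values_eq_source_values)

lemma multilinear_tensor_power_map:
  assumes carrier: "\<And>v. v \<in> carrier_vec n \<Longrightarrow> f v \<in> carrier_vec n"
    and lin: "\<And>a b v w. v \<in> carrier_vec n \<Longrightarrow> w \<in> carrier_vec n \<Longrightarrow>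
      f (a \<cdot>\<^sub>v v + b \<cdot>\<^sub>v w) = a \<cdot>\<^sub>v f v + b \<cdot>\<^sub>v f w"
  shows "multilinear n k (\<lambda>ws. pure_tensor n (map f ws))"
  unfolding multilinear_def
proof (intro allI impI)
  fix us ws :: "complex vec list" and v w :: "complex vec" and a b :: complex and js
  assume len: "length us + 1 + length ws = k"
    and vw: "v \<in> carrier_vec n" "w \<in> carrier_vec n"
  have "(\<Prod>l<k. ((map f us @ (a \<cdot>\<^sub>v f v + b \<cdot>\<^sub>v f w) # map f ws) ! l) $ (js ! l)) =
      a * (\<Prod>l<k. ((map f us @ f v # map f ws) ! l) $ (js ! l)) +
      b * (\<Prod>l<k. ((map f us @ f w # map f ws) ! l) $ (js ! l))" if "js \<in> tensor_idx n k"
    using that len carrier[OF vw(1)] carrier[OF vw(2)] nth_mem[of "length us" js]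
    by (intro prod_slot[where h = "\<lambda>l x. x $ (js ! l)"]) (auto simp: tensor_idx_def subset_iff)
  then show "pure_tensor n (map f (us @ (a \<cdot>\<^sub>v v + b \<cdot>\<^sub>v w) # ws)) js =
      a * pure_tensor n (map f (us @ v # ws)) js + b * pure_tensor n (map f (us @ w # ws)) js"
    using len by (auto simp: pure_tensor_def lin[OF vw])
qed

theorem sink_map_pure:
  assumes "k \<le> n" "length vs = k" "set vs \<subseteq> carrier_vec n"
  shows "sink_map n k (pure_tensor n vs) = (\<lambda>js. \<Sum>is\<in>tensor_idx n (n - k).
     det (mat_of_cols n (vs @ map (unit_vec n) (rev is))) * pure_tensor n (map (unit_vec n) is) js)"
  using tensor_lift_pure[OF multilinear_sink_values[OF assms(1)] assms(2,3)]
  by (simp add: sink_map_def sink_values_def)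

theorem source_map_pure:
  assumes "k \<le> n" "length ws = k" "set ws \<subseteq> carrier_vec n"
  shows "source_map n k (pure_tensor n ws) = (\<lambda>js. \<Sum>is\<in>tensor_idx n (n - k).
     det (mat_of_rows n (ws @ map (unit_vec n) (rev is))) * pure_tensor n (map (unit_vec n) is) js)"
  using tensor_lift_pure[OF multilinear_source_values[OF assms(1)] assms(2,3)]
  by (simp add: source_map_def source_values_def)

theorem tensor_power_map_row_action_pure:
  assumes "A \<in> carrier_mat n n" "length ws = k" "set ws \<subseteq> carrier_vec n"
  shows "tensor_power_map n k (row_action A) (pure_tensor n ws) = pure_tensor n (map (row_action A) ws)"
  unfolding tensor_power_map_def
proof (rule tensor_lift_pure[OF multilinear_tensor_power_map assms(2,3)])
  show "row_action A (a \<cdot>\<^sub>v v + b \<cdot>\<^sub>v w) = a \<cdot>\<^sub>v row_action A v + b \<cdot>\<^sub>v row_action A w"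
    if "v \<in> carrier_vec n" "w \<in> carrier_vec n" for a b v w
    using that assms(1) by (auto simp: row_action_def add_scalar_prod_distrib[of _ n] col_dim)
qed (use assms(1) in \<open>auto simp: row_action_def\<close>)

lemma to_tensor1_in_tensors: "to_tensor1 n v \<in> tensors n 1"
  by (simp add: to_tensor1_def tensors_def pure_tensor_def)

lemma of_tensor1_to_tensor1:
  assumes "v \<in> carrier_vec n" shows "of_tensor1 n (to_tensor1 n v) = v"
  using assms by (auto simp: to_tensor1_def of_tensor1_def pure_tensor_def tensor_idx_def)

lemma to_tensor1_of_tensor1:
  assumes "x \<in> tensors n 1" shows "to_tensor1 n (of_tensor1 n x) = x"
proof
  fix js
  show "to_tensor1 n (of_tensor1 n x) js = x js"
    using assms
    by (cases "js \<in> tensor_idx n 1")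
      (auto simp: tensors_def to_tensor1_def of_tensor1_def pure_tensor_def tensor_idx_def
        length_Suc_conv)
qed

end

theory Submission
  imports Defs
begin

text \<open>
  In coordinates, the \<open>i\<close>-th entry of the composition at \<open>v\<close> is a sum over index lists \<open>is\<close> of the
  product of two determinants, one with the columns \<open>u = A v\<close> and \<open>e\<^sub>j\<close> for \<open>j\<close> in \<open>rev is\<close>, the
  other with the rows \<open>A\<^sub>j\<close> for \<open>j\<close> in \<open>is\<close> followed by \<open>e\<^sub>i\<close>. Reversing the second matrix
  costs the sign \<open>(-1) ^ (n div 2)\<close>. After expanding \<open>u\<close> in the standard basis only the
  permutations survive; the two signs of a permutation \<open>p\<close> cancel and leave
  \<open>u $ p 0\<close> times the cofactor of \<open>A\<close> at \<open>(p 0, i)\<close>. Each row index occurs \<open>(n - 1)!\<close> times, and the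
  sum over the rows is \<open>(adj A (A v)) $ i = det A * v $ i\<close>.
\<close>

section \<open>Determinants under permutation and reversal of rows\<close>

lemma det_mat_of_rows_permute:
  fixes xs :: "'a :: comm_ring_1 vec list"
  assumes len: "length xs = n" and p: "p permutes {0..<n}"
  shows "det (mat_of_rows n (map (\<lambda>i. xs ! p i) [0..<n])) = signof p * det (mat_of_rows n xs)"
proof -
  have eq: "mat_of_rows n (map (\<lambda>i. xs ! p i) [0..<n]) = mat n n (\<lambda>(i, j). mat_of_rows n xs $$ (p i, j))"
    using len permutes_in_image[OF p] by (intro eq_matI) (auto simp: mat_of_rows_index)
  have "mat_of_rows n xs \<in> carrier_mat n n" using len by auto
  from det_permute_rows[OF this p] show ?thesis unfolding eq .
qed

text \<open>Reflecting an interval swaps its two endpoints and reflects the interior. The interior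
  starts at \<open>Suc a\<close> and is shorter by 2, hence the free left end \<open>a\<close> and
  the two-step induction; each step contributes one transposition, which gives the exponent
  \<open>m div 2\<close>.\<close>

lemma reflection_permutes_sign:
  "(\<lambda>i. if a \<le> i \<and> i < a + m then 2 * a + m - 1 - i else i) permutes {a..<a + m} \<and>
   sign (\<lambda>i. if a \<le> i \<and> i < a + m then 2 * a + m - 1 - i else i) = (-1) ^ (m div 2)"
  (is "?R a m permutes _ \<and> _")
proof (induction m arbitrary: a rule: induct_nat_012)
  case 0
  have "?R a 0 = id" by (auto simp: fun_eq_iff)
  then show ?case by (simp only:) simp
next
  case 1
  have "?R a (Suc 0) = id" by (auto simp: fun_eq_iff)
  then show ?case by (simp only:) simp
next
  case (ge2 m)
  let ?t = "transpose a (a + m + 1)"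
  have R: "?R a (Suc (Suc m)) = ?t \<circ> ?R (Suc a) m"
    by (auto simp: fun_eq_iff transpose_def)
  have IH: "?R (Suc a) m permutes {Suc a..<Suc a + m}" "sign (?R (Suc a) m) = (-1) ^ (m div 2)"
    using ge2(1)[of "Suc a"] by blast+
  have t: "?t permutes {a..<a + Suc (Suc m)}" by (rule permutes_swap_id) auto
  have "?R (Suc a) m permutes {a..<a + Suc (Suc m)}"
    by (rule permutes_subset[OF IH(1)]) auto
  then have "?R a (Suc (Suc m)) permutes {a..<a + Suc (Suc m)}"
    unfolding R using t by (rule permutes_compose)
  moreover have "sign (?t \<circ> ?R (Suc a) m) = sign ?t * sign (?R (Suc a) m)"
    by (intro sign_compose permutation_swap_id permutes_imp_permutation[OF _ IH(1)]) simp
  ultimately show ?case unfolding R IH(2) by (simp add: sign_swap_id)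
qed

lemma det_mat_of_rows_rev:
  fixes xs :: "'a :: comm_ring_1 vec list"
  assumes len: "length xs = n"
  shows "det (mat_of_rows n (rev xs)) = (-1) ^ (n div 2) * det (mat_of_rows n xs)"
proof -
  \<comment> \<open>The zeros are kept so that \<open>?R\<close> is literally the reflection for
    \<open>a = 0\<close>, \<open>m = n\<close>.\<close>
  let ?R = "\<lambda>i. if 0 \<le> i \<and> i < 0 + n then 2 * 0 + n - 1 - i else i :: nat"
  have R: "?R permutes {0..<n}" "sign ?R = (-1) ^ (n div 2)"
    using reflection_permutes_sign[of 0 n] by simp_all
  have rev: "rev xs = map (\<lambda>i. xs ! ?R i) [0..<n]"
    using len by (intro nth_equalityI) (auto simp: rev_nth)
  show ?thesis
    unfolding rev det_mat_of_rows_permute[OF len R(1)] R(2) by simp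
qed

section \<open>From sums over index lists to sums over permutations\<close>

text \<open>A list with a repeated index yields two equal rows and determinant 0; a list without
  repetition is the value list of a unique permutation, whose permutation matrix has determinant
  \<open>signof p\<close>. The weight \<open>h\<close> is left arbitrary so that it can later carry
  the second determinant.\<close>

lemma sum_tensor_idx_permutations:
  fixes h :: "nat list \<Rightarrow> complex"
  shows "(\<Sum>is\<in>tensor_idx n n. det (mat_of_rows n (map (unit_vec n) is)) * h is) =
    (\<Sum>p | p permutes {0..<n}. signof p * h (map p [0..<n]))"
proof -
  let ?P = "{p. p permutes {0..<n}}"
  let ?l = "\<lambda>p. map p [0..<n]"
  let ?d = "\<lambda>is. det (mat_of_rows n (map (unit_vec n) is)) :: complex"
  have sub: "?l ` ?P \<subseteq> tensor_idx n n"
  proof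
    fix "is" assume "is \<in> ?l ` ?P"
    then obtain p where p: "p permutes {0..<n}" "is = ?l p" by auto
    then show "is \<in> tensor_idx n n"
      by (simp add: tensor_idx_def permutes_image[OF p(1)] atLeast0LessThan[symmetric])
  qed
  have zero: "?d is = 0" if "is \<in> tensor_idx n n - ?l ` ?P" for "is"
  proof -
    have len: "length is = n" and set: "set is \<subseteq> {..<n}" using that by (auto simp: tensor_idx_def)
    have "\<not> distinct is"
    proof
      assume d: "distinct is"
      \<comment> \<open>Outside the index range the identity is the only extension that
        \<open>permutes\<close> allows.\<close>
      define p where "p i = (if i < n then is ! i else i)" for i
      have "set is = {..<n}"
        using d len set by (intro card_subset_eq) (simp_all add: distinct_card)
      then have "bij_betw (\<lambda>i. is ! i) {0..<n} {0..<n}"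
        using bij_betw_nth[OF d, of "{0..<n}" "{0..<n}"] len by (simp add: atLeast0LessThan)
      then have "bij_betw p {0..<n} {0..<n}"
        by (subst bij_betw_cong[where g = "\<lambda>i. is ! i"]) (auto simp: p_def)
      then have "p permutes {0..<n}" by (rule bij_imp_permutes) (simp add: p_def)
      moreover have "is = ?l p" using len by (intro nth_equalityI) (auto simp: p_def)
      ultimately show False using that by auto
    qed
    then obtain i j where ij: "i < n" "j < n" "i \<noteq> j" "is ! i = is ! j"
      using len by (auto simp: distinct_conv_nth)
    show ?thesis
      by (rule det_identical_rows[of _ n i j]) (use ij len in auto)
  qed
  have inj: "inj_on ?l ?P"
  proof (rule inj_onI)
    fix p q assume *: "p \<in> ?P" "q \<in> ?P" "?l p = ?l q"
    then have "p permutes {0..<n}" "q permutes {0..<n}" "\<forall>i\<in>{0..<n}. p i = q i" by auto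
    then show "p = q" by (metis ext permutes_not_in)
  qed
  have d: "?d (?l p) = signof p" if "p permutes {0..<n}" for p
  proof -
    \<comment> \<open>The rows are those of the identity matrix, permuted by
      \<open>p\<close>.\<close>
    have eq: "map (unit_vec n) (?l p) = map (\<lambda>i. map (unit_vec n) [0..<n] ! p i) [0..<n]"
      using permutes_in_image[OF that] by (auto simp: atLeast0LessThan)
    then have "?d (?l p) = signof p * det (mat_of_rows n (map (unit_vec n) [0..<n]) :: complex mat)"
      unfolding eq by (intro det_mat_of_rows_permute that) simp
    also have "mat_of_rows n (map (unit_vec n) [0..<n]) = (1\<^sub>m n :: complex mat)"
      by (intro eq_matI) (auto simp: mat_of_rows_index)
    finally show ?thesis by simp
  qed
  have "(\<Sum>is\<in>tensor_idx n n. ?d is * h is) = (\<Sum>is\<in>?l ` ?P. ?d is * h is)"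
    using sub zero by (intro sum.mono_neutral_right) auto
  also have "\<dots> = (\<Sum>p\<in>?P. signof p * h (?l p))"
    unfolding sum.reindex[OF inj] o_apply by (intro sum.cong refl) (simp only: d mem_Collect_eq)
  finally show ?thesis .
qed

text \<open>Composing with a transposition shows that the sum does not depend on the point at which the
  permutations are evaluated; averaging over all points avoids counting stabilizers.\<close>

lemma sum_permutations_apply:
  fixes f :: "nat \<Rightarrow> 'a :: field_char_0"
  assumes k: "k < n"
  shows "(\<Sum>p | p permutes {0..<n}. f (p k)) = fact (n - 1) * (\<Sum>i<n. f i)"
proof -
  let ?P = "{p. p permutes {0..<n}}"
  have indep: "(\<Sum>p\<in>?P. f (p k)) = (\<Sum>p\<in>?P. f (p j))" if "j < n" for j
  proof -
    have "transpose k j permutes {0..<n}" using k that by (intro permutes_swap_id) auto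
    from sum_permutations_compose_right[OF this, of "\<lambda>p. f (p k)"] show ?thesis by simp
  qed
  have "of_nat n * (\<Sum>p\<in>?P. f (p k)) = (\<Sum>j<n. \<Sum>p\<in>?P. f (p k))" by simp
  also have "\<dots> = (\<Sum>j<n. \<Sum>p\<in>?P. f (p j))"
    by (intro sum.cong refl indep) simp
  also have "\<dots> = (\<Sum>p\<in>?P. \<Sum>j<n. f (p j))" by (rule sum.swap)
  also have "\<dots> = (\<Sum>p\<in>?P. \<Sum>i<n. f i)"
    by (intro sum.cong refl sum.reindex_bij_betw)
      (auto simp: atLeast0LessThan dest: permutes_imp_bij)
  also have "\<dots> = of_nat n * (fact (n - 1) * (\<Sum>i<n. f i))"
    using k by (simp add: card_permutations fact_reduce)
  finally show ?thesis using k by simp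
qed

section \<open>Cofactors and the adjugate\<close>

text \<open>In the Laplace expansion along row \<open>m\<close> only column \<open>i\<close>
  survives, and its minor omits row \<open>m\<close>, so it does not see the replacement.\<close>

lemma det_replace_row_unit:
  fixes A :: "'a :: comm_ring_1 mat"
  assumes A: "A \<in> carrier_mat n n" and m: "m < n" and i: "i < n"
  shows "det (mat_of_rows n ((rows A)[m := unit_vec n i])) = cofactor A m i"
proof -
  let ?B = "mat_of_rows n ((rows A)[m := unit_vec n i])"
  have B: "?B \<in> carrier_mat n n" using A by auto
  have entry: "?B $$ (k, j) = (if k = m then unit_vec n i $ j else A $$ (k, j))" if "k < n" "j < n" for k j
    using that A m by (auto simp: mat_of_rows_index nth_list_update)
  have "mat_delete ?B m j = mat_delete A m j" if "j < n" for j
    using A B m that by (intro eq_matI) (auto simp: mat_delete_def entry)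
  then have "det ?B = (\<Sum>j<n. (if j = i then 1 else 0) * cofactor A m j)"
    unfolding laplace_expansion_row[OF B m]
    by (intro sum.cong) (auto simp: entry m i cofactor_def)
  also have "\<dots> = cofactor A m i" using i by (simp add: if_distrib if_distribR cong: if_cong)
  finally show ?thesis .
qed

lemma sum_mult_mat_vec_cofactor:
  fixes A :: "'a :: comm_ring_1 mat"
  assumes A: "A \<in> carrier_mat n n" and v: "v \<in> carrier_vec n" and i: "i < n"
  shows "(\<Sum>m<n. (A *\<^sub>v v) $ m * cofactor A m i) = det A * v $ i"
proof -
  have "(\<Sum>m<n. (A *\<^sub>v v) $ m * cofactor A m i) = (adj_mat A *\<^sub>v (A *\<^sub>v v)) $ i"
    using A v i by (auto simp: adj_mat_def scalar_prod_def atLeast0LessThan mult.commute intro!: sum.cong)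
  also have "adj_mat A *\<^sub>v (A *\<^sub>v v) = (det A \<cdot>\<^sub>m 1\<^sub>m n) *\<^sub>v v"
    using assoc_mult_mat_vec[OF adj_mat(1)[OF A] A v] adj_mat(3)[OF A] by simp
  also have "\<dots> $ i = det A * v $ i"
    using v i by simp
  finally show ?thesis .
qed

section \<open>Summing the products of two determinants\<close>

lemma sum_det_rows_det_rows:
  fixes A :: "complex mat"
  assumes n: "n \<ge> 1" and A: "A \<in> carrier_mat n n" and u: "u \<in> carrier_vec n" and i: "i < n"
  shows "(\<Sum>is\<in>tensor_idx n (n - 1). det (mat_of_rows n (u # map (unit_vec n) is)) *
      det (mat_of_rows n (unit_vec n i # map (row A) is))) =
    fact (n - 1) * (\<Sum>m<n. u $ m * cofactor A m i)"
proof -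
  have Suc_n: "Suc (n - 1) = n" using n by simp
  let ?D = "\<lambda>is. det (mat_of_rows n (unit_vec n i # map (row A) is))"
  \<comment> \<open>The determinant is viewed as a tensor-valued map constant in its index, so that
    \<open>multilinear_expand\<close> applies to the row \<open>u\<close>.\<close>
  have multi: "multilinear n n (\<lambda>ws _. det (mat_of_rows n ws))"
    unfolding multilinear_def using det_rows_slot by blast
  have expand: "det (mat_of_rows n (u # map (unit_vec n) is)) =
      (\<Sum>m<n. u $ m * det (mat_of_rows n (map (unit_vec n) (m # is))))" if "is \<in> tensor_idx n (n - 1)" for "is"
    using multilinear_expand[OF multi, of "[]" "map (unit_vec n) is" u] that n u
    by (auto simp: tensor_idx_def image_subset_iff)
  \<comment> \<open>The tail omits \<open>p 0\<close>, and the unit vector fills that place: the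
    matrix is \<open>A\<close> with row \<open>p 0\<close> replaced, then permuted by
    \<open>p\<close>. Injectivity of \<open>p\<close> keeps the other rows untouched.\<close>
  have perm: "?D (tl (map p [0..<n])) = signof p * cofactor A (p 0) i" if p: "p permutes {0..<n}" for p
  proof -
    have p0: "p 0 < n" using permutes_in_image[OF p, of 0] n by simp
    have pk: "p k < n" if "k < n" for k using permutes_in_image[OF p, of k] that by simp
    have "unit_vec n i # map (row A) (tl (map p [0..<n])) =
        map (\<lambda>k. (rows A)[p 0 := unit_vec n i] ! p k) [0..<n]"
    proof (rule nth_equalityI)
      fix k assume "k < length (unit_vec n i # map (row A) (tl (map p [0..<n])))"
      then have k: "k < n" using n by simp
      have "p k \<noteq> p 0" if "k \<noteq> 0" using that permutes_inj[OF p] by (auto dest: injD)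
      then show "(unit_vec n i # map (row A) (tl (map p [0..<n]))) ! k =
          map (\<lambda>k. (rows A)[p 0 := unit_vec n i] ! p k) [0..<n] ! k"
        using k pk[OF k] p0 A by (cases k) (auto simp: nth_tl)
    qed (use n in simp)
    then show ?thesis
      using det_mat_of_rows_permute[OF _ p, of "(rows A)[p 0 := unit_vec n i]"] A
      by (simp add: det_replace_row_unit[OF A p0 i])
  qed
  \<comment> \<open>The summation index from the expansion of \<open>u\<close> becomes the head of a
    list of length \<open>n\<close>, so that the permutation formula applies.\<close>
  have "(\<Sum>is\<in>tensor_idx n (n - 1). det (mat_of_rows n (u # map (unit_vec n) is)) * ?D is) =
      (\<Sum>is\<in>tensor_idx n (Suc (n - 1)).
        det (mat_of_rows n (map (unit_vec n) is)) * (u $ hd is * ?D (tl is)))"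
    unfolding sum_tensor_idx_Suc
    by (subst sum.swap) (auto simp: expand sum_distrib_left sum_distrib_right mult_ac intro!: sum.cong)
  also have "\<dots> = (\<Sum>p | p permutes {0..<n}.
      signof p * (u $ hd (map p [0..<n]) * ?D (tl (map p [0..<n]))))"
    unfolding Suc_n sum_tensor_idx_permutations ..
  also have "\<dots> = (\<Sum>p | p permutes {0..<n}. u $ p 0 * cofactor A (p 0) i)"
  proof (rule sum.cong, rule refl)
    fix p assume "p \<in> {p. p permutes {0..<n}}"
    then have p: "p permutes {0..<n}" by simp
    have "hd (map p [0..<n]) = p 0" using n by (simp add: hd_map)
    moreover have "(signof p :: complex) * signof p = 1" by (simp add: sign_def)
    ultimately show "signof p * (u $ hd (map p [0..<n]) * ?D (tl (map p [0..<n]))) =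
        u $ p 0 * cofactor A (p 0) i"
      unfolding perm[OF p] by (simp add: algebra_simps)
  qed
  also have "\<dots> = fact (n - 1) * (\<Sum>m<n. u $ m * cofactor A m i)"
    using n by (intro sum_permutations_apply) simp
  finally show ?thesis .
qed

section \<open>Coordinates of the diagram maps and the final computation\<close>

lemma row_action_unit_vec:
  assumes "A \<in> carrier_mat n n" "j < n"
  shows "row_action A (unit_vec n j) = row A j"
  using assms by (auto simp: row_action_def)

lemma source_map_tensor_power_row_action:
  assumes n: "n \<ge> 1" and A: "A \<in> carrier_mat n n" and i: "i < n"
  shows "source_map n (n - 1) (tensor_power_map n (n - 1) (row_action A) x) [i] =
    (\<Sum>is\<in>tensor_idx n (n - 1). x is * det (mat_of_rows n (map (row A) is @ [unit_vec n i])))"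
proof -
  have pure: "source_map n (n - 1) (pure_tensor n (map (row_action A) (map (unit_vec n) is))) [i] =
      det (mat_of_rows n (map (row A) is @ [unit_vec n i]))" if "is \<in> tensor_idx n (n - 1)" for "is"
  proof -
    have eq: "map (row_action A) (map (unit_vec n) is) = map (row A) is"
      using that A by (auto simp: tensor_idx_def subset_iff row_action_unit_vec)
    have "n - (n - 1) = Suc 0" using n by simp
    moreover have "set (map (row A) is) \<subseteq> carrier_vec n" using A by auto
    moreover have "length (map (row A) is) = n - 1" using that by (simp add: tensor_idx_def)
    ultimately have "source_map n (n - 1) (pure_tensor n (map (row A) is)) [i] =
        (\<Sum>j<n. det (mat_of_rows n (map (row A) is @ [unit_vec n j])) * pure_tensor n [unit_vec n j] [i])"
      by (simp add: source_map_pure sum_tensor_idx_Suc)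
    also have "\<dots> = (\<Sum>j<n. if j = i then det (mat_of_rows n (map (row A) is @ [unit_vec n j])) else 0)"
    proof (intro sum.cong refl)
      fix j assume "j \<in> {..<n}"
      then have "[j] \<in> tensor_idx n 1" by (simp add: tensor_idx_def)
      from pure_tensor_unit_vec[OF this, of "[i]"]
      show "det (mat_of_rows n (map (row A) is @ [unit_vec n j])) * pure_tensor n [unit_vec n j] [i] =
          (if j = i then det (mat_of_rows n (map (row A) is @ [unit_vec n j])) else 0)"
        by auto
    qed
    also have "\<dots> = det (mat_of_rows n (map (row A) is @ [unit_vec n i]))" using i by simp
    finally show ?thesis unfolding eq .
  qed
  \<comment> \<open>Interchanging the two coordinate sums applies \<open>source_map\<close> to the
    image of each basis tensor separately.\<close>
  have "source_map n (n - 1) (tensor_power_map n (n - 1) (row_action A) x) [i] =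
      (\<Sum>is\<in>tensor_idx n (n - 1). x is *
        source_map n (n - 1) (pure_tensor n (map (row_action A) (map (unit_vec n) is))) [i])"
    unfolding source_map_def tensor_power_map_def tensor_lift_def sum_distrib_left sum_distrib_right
    by (subst sum.swap) (simp add: mult.assoc)
  then show ?thesis by (simp only: pure cong: sum.cong)
qed

lemma sink_map_1:
  assumes n: "n \<ge> 1" and u: "u \<in> carrier_vec n" and "is": "is \<in> tensor_idx n (n - 1)"
  shows "sink_map n 1 (to_tensor1 n u) is = det (mat_of_rows n (u # map (unit_vec n) (rev is)))"
proof -
  have "sink_map n 1 (to_tensor1 n u) is = (\<Sum>js\<in>tensor_idx n (n - 1).
      if js = is then det (mat_of_cols n (u # map (unit_vec n) (rev js))) else 0)"
    using n u unfolding to_tensor1_def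
    by (simp only: sink_map_pure list.size list.set One_nat_def add_0 empty_subsetI insert_subset)
      (auto simp: pure_tensor_unit_vec simp del: sum.delta sum.delta' intro!: sum.cong)
  \<comment> \<open>Passing from columns to rows lets both vertices be treated by the same row
    lemmas.\<close>
  also have "\<dots> = det (mat_of_cols n (u # map (unit_vec n) (rev is)))" using "is" by simp
  also have "\<dots> = det (mat_of_rows n (u # map (unit_vec n) (rev is)))"
    using n "is" by (intro det_cols_eq_det_rows) (simp add: tensor_idx_def)
  finally show ?thesis .
qed

theorem proposition6p1:
  fixes n :: nat and A :: "complex mat"
  assumes "n \<ge> 1" and "A \<in> carrier_mat n n"
  shows "\<forall>v \<in> carrier_vec n.
    (of_tensor1 n \<circ> source_map n (n - 1) \<circ> tensor_power_map n (n - 1) (row_action A) \<circ> sink_map n 1 \<circ> to_tensor1 n \<circ> (*\<^sub>v) A) v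
      = ((-1) ^ (n div 2) * fact (n - 1) * det A) \<cdot>\<^sub>v v"
proof
  fix v :: "complex vec" assume v: "v \<in> carrier_vec n"
  let ?u = "A *\<^sub>v v"
  let ?x = "sink_map n 1 (to_tensor1 n ?u)"
  have u: "?u \<in> carrier_vec n" using assms(2) v by simp
  have "source_map n (n - 1) (tensor_power_map n (n - 1) (row_action A) ?x) [i] =
      (-1) ^ (n div 2) * fact (n - 1) * det A * v $ i" if i: "i < n" for i
  proof -
    have "source_map n (n - 1) (tensor_power_map n (n - 1) (row_action A) ?x) [i] =
        (\<Sum>is\<in>tensor_idx n (n - 1). det (mat_of_rows n (?u # map (unit_vec n) (rev is))) *
          det (mat_of_rows n (map (row A) is @ [unit_vec n i])))"
      using assms u i by (simp only: source_map_tensor_power_row_action sink_map_1 cong: sum.cong)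
    \<comment> \<open>Substituting \<open>rev is\<close> moves the reversal to the source
      determinant. There it reverses all \<open>n\<close> rows, the unit row included, so the sign
      has exponent \<open>n div 2\<close> and not \<open>(n - 1) div 2\<close>.\<close>
    also have "\<dots> = (\<Sum>is\<in>tensor_idx n (n - 1). det (mat_of_rows n (?u # map (unit_vec n) is)) *
          det (mat_of_rows n (rev (unit_vec n i # map (row A) is))))"
      by (rule sum.reindex_bij_witness[where i = rev and j = rev])
        (auto simp: tensor_idx_def rev_map)
    also have "\<dots> = (-1) ^ (n div 2) * (\<Sum>is\<in>tensor_idx n (n - 1).
        det (mat_of_rows n (?u # map (unit_vec n) is)) *
          det (mat_of_rows n (unit_vec n i # map (row A) is)))"
      unfolding sum_distrib_left
    proof (rule sum.cong, rule refl)
      fix "is" assume "is \<in> tensor_idx n (n - 1)"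
      then have "length (unit_vec n i # map (row A) is) = n" using assms(1) by (simp add: tensor_idx_def)
      from det_mat_of_rows_rev[OF this]
      show "det (mat_of_rows n (?u # map (unit_vec n) is)) *
          det (mat_of_rows n (rev (unit_vec n i # map (row A) is))) =
        (-1) ^ (n div 2) * (det (mat_of_rows n (?u # map (unit_vec n) is)) *
          det (mat_of_rows n (unit_vec n i # map (row A) is)))" by simp
    qed
    finally show ?thesis
      using sum_det_rows_det_rows[OF assms u i] sum_mult_mat_vec_cofactor[OF assms(2) v i] by simp
  qed
  then show "(of_tensor1 n \<circ> source_map n (n - 1) \<circ> tensor_power_map n (n - 1) (row_action A) \<circ>
      sink_map n 1 \<circ> to_tensor1 n \<circ> (*\<^sub>v) A) v = ((-1) ^ (n div 2) * fact (n - 1) * det A) \<cdot>\<^sub>v v"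
    using v by (auto simp: of_tensor1_def)
qed

end
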